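(* Let $\mathcal F$ be a finite set of flows, $\mathcal R$ a finite set of APs with $|\mathcal R|=R\ge 2$, and costs $e_i^f>0$ ($i\in\mathcal R$, $f\in\mathcal F$). For each $f\in\mathcal F$ let $u_f:[0,\infty)\to\mathbb R$ be twice differentiable with continuous first derivative, $u_f'>0$, $u_f''\le 0$ and $u_f(0)=0$. Consider the leaders' game without capacity limit, in which each flow $f$ chooses $C^f\in[0,\infty)$ and has utility $U_f=u_f\left(\sum_{i\in\mathcal R}\log(1+\widetilde r_i^f)\right)-C^f$, where $\widetilde{\mathbf r}=\widetilde{\mathbf r}(\mathbf C)$ is the followers' equilibrium response described in the context. Then the leaders' game has a unique Nash equilibrium.
   Context: Given payments $\mathbf C=(C^f)_{f\in\mathcal F}$, in the followers' game without capacity limit AP $i\in\mathcal R$ chooses $(r_i^f)_{f\in\mathcal F}\in[0,\infty)^{\mathcal F}$ to maximize $V_i=\sum_{f\in\mathcal F}\left[C^f\frac{r_i^f}{\sum_{j\in\mathcal R}r_j^f}-e_i^f r_i^f\right]$ (fraction read as $0$ when all $r_j^f=0$). The followers respond to $\mathbf C$ with the Nash equilibrium of this game, which is given by $$\widetilde r_i^f=C^f k_i^f \text{ for } i\in\mathcal S_f,\quad \widetilde r_i^f=0 \text{ for } i\notin\mathcal S_f,\qquad k_i^f=\frac{|\mathcal S_f|-1}{\sum_{j\in\mathcal S_f}e_j^f}\left(1-\frac{(|\mathcal S_f|-1)e_i^f}{\sum_{j\in\mathcal S_f}e_j^f}\right).$$ The set $\mathcal S_f$ is obtained as follows: sort APs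 so that $e^f_{\sigma_1}\le\cdots\le e^f_{\sigma_R}$; start with $\mathcal S_f=\{\sigma_1,\sigma_2\}$, $i=3$; while $i\le R$ and $e^f_{\sigma_i}<\frac{\sum_{j\in\mathcal S_f}e_j^f}{|\mathcal S_f|-1}$, add $\sigma_i$ to $\mathcal S_f$ and increase $i$ by $1$. *)

theory Defs
  imports Complex_Main "HOL-Library.FuncSet"
begin

definition nash_equilibrium ::
  "'p set \<Rightarrow> ('p \<Rightarrow> 's set) \<Rightarrow> ('p \<Rightarrow> ('p \<Rightarrow> 's) \<Rightarrow> real) \<Rightarrow> ('p \<Rightarrow> 's) \<Rightarrow> bool"
  where "nash_equilibrium P A U s \<longleftrightarrow>
    s \<in> Pi\<^sub>E P A \<and> (\<forall>i\<in>P. \<forall>a\<in>A i. U i (s(i := a)) \<le> U i s)"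

text \<open>
  \<open>R\<close> is the set of APs, \<open>F\<close> the set of flows, \<open>e i f\<close> the unit cost of AP \<open>i\<close> for flow \<open>f\<close>,
  \<open>C f\<close> the payment of flow \<open>f\<close>, and \<open>r i f\<close> the amount AP \<open>i\<close> provides to flow \<open>f\<close>.
  When nobody serves \<open>f\<close> the share below is \<open>0 / 0\<close>, which is \<open>0\<close> in HOL, as intended.
\<close>

definition follower_utility ::
  "'a set \<Rightarrow> 'f set \<Rightarrow> ('a \<Rightarrow> 'f \<Rightarrow> real) \<Rightarrow> ('f \<Rightarrow> real) \<Rightarrow> 'a \<Rightarrow> ('a \<Rightarrow> 'f \<Rightarrow> real) \<Rightarrow> real"
  where "follower_utility R F e C i r =
    (\<Sum>f\<in>F. C f * (r i f / (\<Sum>j\<in>R. r j f)) - e i f * r i f)"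

definition follower_equilibrium ::
  "'a set \<Rightarrow> 'f set \<Rightarrow> ('a \<Rightarrow> 'f \<Rightarrow> real) \<Rightarrow> ('f \<Rightarrow> real) \<Rightarrow> ('a \<Rightarrow> 'f \<Rightarrow> real) \<Rightarrow> bool"
  where "follower_equilibrium R F e C =
    nash_equilibrium R (\<lambda>_. F \<rightarrow>\<^sub>E {0..}) (follower_utility R F e C)"

text \<open>
  The definite description is justified, and the explicit form of the response established, by
  \<open>follower_equilibrium_unique\<close> and \<open>follower_response_explicit\<close> below.
\<close>

definition follower_response ::
  "'a set \<Rightarrow> 'f set \<Rightarrow> ('a \<Rightarrow> 'f \<Rightarrow> real) \<Rightarrow> ('f \<Rightarrow> real) \<Rightarrow> 'a \<Rightarrow> 'f \<Rightarrow> real"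
  where "follower_response R F e C = (THE r. follower_equilibrium R F e C r)"

definition leader_utility ::
  "'a set \<Rightarrow> 'f set \<Rightarrow> ('a \<Rightarrow> 'f \<Rightarrow> real) \<Rightarrow> ('f \<Rightarrow> real \<Rightarrow> real) \<Rightarrow> 'f \<Rightarrow> ('f \<Rightarrow> real) \<Rightarrow> real"
  where "leader_utility R F e u f C =
    u f (\<Sum>i\<in>R. ln (1 + follower_response R F e C i f)) - C f"

definition leader_equilibrium ::
  "'a set \<Rightarrow> 'f set \<Rightarrow> ('a \<Rightarrow> 'f \<Rightarrow> real) \<Rightarrow> ('f \<Rightarrow> real \<Rightarrow> real) \<Rightarrow> ('f \<Rightarrow> real) \<Rightarrow> bool"
  where "leader_equilibrium R F e u =
    nash_equilibrium F (\<lambda>_. {0..}) (leader_utility R F e u)"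

subsection \<open>Explicit form of the followers' response\<close>

text \<open>
  For a single flow with costs \<open>c\<close>, the served set is grown greedily along a list of the APs
  sorted by cost, starting from the two cheapest ones.
\<close>

primrec grow :: "('a \<Rightarrow> real) \<Rightarrow> 'a set \<Rightarrow> 'a list \<Rightarrow> 'a set" where
  "grow c S [] = S"
| "grow c S (x # xs) =
    (if c x < sum c S / (real (card S) - 1) then grow c (insert x S) xs else S)"

definition active_set :: "('a \<Rightarrow> real) \<Rightarrow> 'a list \<Rightarrow> 'a set"
  where "active_set c \<sigma> = grow c (set (take 2 \<sigma>)) (drop 2 \<sigma>)"

definition response_coeff :: "('a \<Rightarrow> real) \<Rightarrow> 'a set \<Rightarrow> 'a \<Rightarrow> real"
  where "response_coeff c S i =
    (real (card S) - 1) / sum c S * (1 - (real (card S) - 1) * c i / sum c S)"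

lemma grow_spec:
  assumes "finite S" "2 \<le> card S" "\<forall>i\<in>S. 0 < c i"
    and "\<forall>i\<in>S. (real (card S) - 1) * c i < sum c S"
    and "\<forall>i\<in>S. \<forall>j\<in>set xs. c i \<le> c j"
    and "sorted (map c xs)" "distinct xs" "S \<inter> set xs = {}" "\<forall>i\<in>set xs. 0 < c i"
  shows "S \<subseteq> grow c S xs \<and> grow c S xs \<subseteq> S \<union> set xs \<and>
    (\<forall>i\<in>grow c S xs. (real (card (grow c S xs)) - 1) * c i < sum c (grow c S xs)) \<and>
    (\<forall>i\<in>S \<union> set xs - grow c S xs.
      sum c (grow c S xs) \<le> (real (card (grow c S xs)) - 1) * c i)"
  using assms
proof (induction xs arbitrary: S)
  case Nil
  then show ?case by simp
next
  case (Cons x xs)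
  have n: "real (card S) - 1 > 0" using Cons.prems(2) by simp
  show ?case
  proof (cases "c x < sum c S / (real (card S) - 1)")
    case True
    then have lt: "(real (card S) - 1) * c x < sum c S"
      using n by (simp add: field_simps)
    have x: "x \<notin> S" using Cons.prems(8) by simp
    have card: "card (insert x S) = Suc (card S)" "sum c (insert x S) = c x + sum c S"
      using x Cons.prems(1) by simp_all
    have ex: "real (card S) * c x < c x + sum c S"
      using lt by (simp add: algebra_simps)
    have "\<forall>i\<in>insert x S. (real (card (insert x S)) - 1) * c i < sum c (insert x S)"
    proof
      fix i assume "i \<in> insert x S"
      then have "c i \<le> c x" using Cons.prems(5) by auto
      then have "real (card S) * c i \<le> real (card S) * c x"
        by (simp add: mult_left_mono)
      then show "(real (card (insert x S)) - 1) * c i < sum c (insert x S)"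
        using ex card by simp
    qed
    then have "insert x S \<subseteq> grow c (insert x S) xs \<and>
      grow c (insert x S) xs \<subseteq> insert x S \<union> set xs \<and>
      (\<forall>i\<in>grow c (insert x S) xs.
        (real (card (grow c (insert x S) xs)) - 1) * c i < sum c (grow c (insert x S) xs)) \<and>
      (\<forall>i\<in>insert x S \<union> set xs - grow c (insert x S) xs.
        sum c (grow c (insert x S) xs) \<le> (real (card (grow c (insert x S) xs)) - 1) * c i)"
      using Cons.prems card(1) by (intro Cons.IH) auto
    then show ?thesis using True by auto
  next
    case False
    have "sum c S \<le> (real (card S) - 1) * c i" if "i \<in> set (x # xs)" for i
    proof -
      have "c x \<le> c i" using that Cons.prems(6) by auto
      then have "(real (card S) - 1) * c x \<le> (real (card S) - 1) * c i"
        using n by simp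
      moreover have "sum c S \<le> (real (card S) - 1) * c x"
        using False n by (simp add: field_simps)
      ultimately show ?thesis by linarith
    qed
    then show ?thesis using False Cons.prems(4) by auto
  qed
qed

lemma active_set_spec:
  assumes "set \<sigma> = R" "distinct \<sigma>" "sorted (map c \<sigma>)" "2 \<le> card R" "\<forall>i\<in>R. 0 < c i"
  defines "S \<equiv> active_set c \<sigma>"
  shows "S \<subseteq> R" "2 \<le> card S" "\<forall>i\<in>S. (real (card S) - 1) * c i < sum c S"
    "\<forall>i\<in>R - S. sum c S \<le> (real (card S) - 1) * c i"
proof -
  have "2 \<le> length \<sigma>" using assms(1,2,4) distinct_card by metis
  then obtain a b xs where \<sigma>: "\<sigma> = a # b # xs"
    by (metis One_nat_def Suc_1 Suc_le_length_iff)
  have S: "S = grow c {a, b} xs"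
    unfolding S_def active_set_def \<sigma> by (simp add: numeral_2_eq_2)
  have ab: "a \<noteq> b" "0 < c a" "0 < c b" using assms(1,2,5) \<sigma> by auto
  have "{a, b} \<subseteq> S \<and> S \<subseteq> {a, b} \<union> set xs \<and>
    (\<forall>i\<in>S. (real (card S) - 1) * c i < sum c S) \<and>
    (\<forall>i\<in>{a, b} \<union> set xs - S. sum c S \<le> (real (card S) - 1) * c i)"
    unfolding S using assms(1-3,5) ab \<sigma> by (intro grow_spec) auto
  moreover have "{a, b} \<union> set xs = R" using assms(1) \<sigma> by auto
  ultimately have *: "{a, b} \<subseteq> S" "S \<subseteq> R" "\<forall>i\<in>S. (real (card S) - 1) * c i < sum c S"
    "\<forall>i\<in>R - S. sum c S \<le> (real (card S) - 1) * c i" by auto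
  have "finite S" using *(2) assms(1) finite_subset by blast
  then have "card {a, b} \<le> card S" using *(1) card_mono by blast
  then show "2 \<le> card S" using ab by simp
  show "S \<subseteq> R" "\<forall>i\<in>S. (real (card S) - 1) * c i < sum c S"
    "\<forall>i\<in>R - S. sum c S \<le> (real (card S) - 1) * c i" using * by auto
qed

text \<open>One flow with payment \<open>C\<close>: \<open>s\<close> is the total amount provided by the other APs.\<close>

definition best_reply :: "real \<Rightarrow> real \<Rightarrow> real \<Rightarrow> real \<Rightarrow> bool"
  where "best_reply C e s x \<longleftrightarrow>
    (\<forall>y\<ge>0. C * (y / (y + s)) - e * y \<le> C * (x / (x + s)) - e * x)"

lemma contest_diff:
  fixes s x y C e :: real
  assumes "s > 0" "x \<ge> 0" "y \<ge> 0"
  shows "(C * (y / (y + s)) - e * y) - (C * (x / (x + s)) - e * x) =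
    (y - x) * (C * s / ((x + s) * (y + s)) - e)"
proof -
  have "x + s \<noteq> 0" "y + s \<noteq> 0" using assms by auto
  then show ?thesis by (simp add: divide_simps) (simp add: algebra_simps)
qed

lemma best_reply_zero:
  assumes "best_reply 0 e s x" "e > 0" "x \<ge> 0"
  shows "x = 0"
proof -
  have "e * x \<le> 0" using assms(1) unfolding best_reply_def by (auto dest: spec[of _ 0])
  then show ?thesis using assms(2,3) by (simp add: mult_le_0_iff)
qed

lemma best_reply_necessary:
  assumes b: "best_reply C e s x" and "C > 0" "e > 0" "s \<ge> 0" "x \<ge> 0"
  shows "s > 0" "x = (x + s) * max 0 (1 - e * (x + s) / C)"
proof -
  show s: "s > 0"
  proof (rule ccontr)
    assume "\<not> s > 0"
    then have s: "s = 0" using assms by simp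
    show False
    proof (cases "x = 0")
      case True
      define y where "y = C / (2 * e)"
      have y: "y > 0" "e * y = C / 2" using assms by (auto simp: y_def field_simps)
      then have "C * (y / (y + s)) - e * y \<le> C * (x / (x + s)) - e * x"
        using b unfolding best_reply_def by auto
      then show False using y True s assms by simp
    next
      case False
      then have "C * (x / 2 / (x / 2 + s)) - e * (x / 2) \<le> C * (x / (x + s)) - e * x"
        using b assms(5) unfolding best_reply_def by (auto dest: spec[of _ "x / 2"] simp del: divide_divide_eq_left times_divide_eq_right)
      then show False using False s assms by simp
    qed
  qed
  define T where "T = x + s"
  have T: "T > 0" using s assms by (simp add: T_def)
  define q where "q = C * s / (e * T)"
  have q: "q > 0" using s assms T by (simp add: q_def)
  have gain: "(y - x) * (q / (y + s) - 1) \<le> 0" if "y \<ge> 0" for y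
  proof -
    have "C * (y / (y + s)) - e * y \<le> C * (x / (x + s)) - e * x"
      using b that unfolding best_reply_def by auto
    then have "(y - x) * (C * s / ((x + s) * (y + s)) - e) \<le> 0"
      using contest_diff[OF s assms(5) that, of C e] by linarith
    moreover have "C * s / ((x + s) * (y + s)) - e = e * (q / (y + s) - 1)"
    proof -
      have "x + s \<noteq> 0" "y + s \<noteq> 0" "e \<noteq> 0" using s that assms by auto
      then show ?thesis by (simp add: q_def T_def right_diff_distrib)
    qed
    ultimately have "e * ((y - x) * (q / (y + s) - 1)) \<le> 0" by (simp add: ac_simps)
    then show ?thesis using assms(3) by (simp add: mult_le_0_iff)
  qed
  have le: "q \<le> T"
  proof (rule ccontr)
    assume "\<not> q \<le> T"
    define y where "y = (T + q) / 2 - s"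
    have y: "y > x" "y + s < q" "y \<ge> 0" "y + s > 0"
      using \<open>\<not> q \<le> T\<close> s assms unfolding y_def T_def by (auto simp: field_simps)
    then have "(y - x) * (q / (y + s) - 1) > 0" by (intro mult_pos_pos) auto
    then show False using gain[OF y(3)] by simp
  qed
  have ge: "q \<ge> T" if "x > 0"
  proof (rule ccontr)
    assume "\<not> q \<ge> T"
    define y where "y = max 0 ((T + q) / 2 - s)"
    have y: "y < x" "y \<ge> 0" "y + s > 0"
      using \<open>\<not> q \<ge> T\<close> s that unfolding y_def T_def by (auto simp: field_simps)
    have "y + s > q"
      using \<open>\<not> q \<ge> T\<close> unfolding y_def by (auto simp: field_simps max_def)
    then have "(y - x) * (q / (y + s) - 1) > 0" using y by (intro mult_neg_neg) auto
    then show False using gain[OF y(2)] by simp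
  qed
  have "x = T * max 0 (1 - e * T / C)"
  proof (cases "x = 0")
    case True
    then have "s = T" by (simp add: T_def)
    then have "C \<le> e * T" using le T assms(3) by (simp add: q_def field_simps)
    then show ?thesis using True assms(2) by (simp add: field_simps)
  next
    case False
    then have "q = T" using le ge assms(5) by simp
    then have "C * s = e * T * T" using T assms(3) by (simp add: q_def field_simps)
    then have sx: "s = T * (e * T / C)" using assms(2) by (simp add: field_simps)
    have "x = T * (1 - e * T / C)"
    proof -
      have "x = T - s" by (simp add: T_def)
      also have "\<dots> = T * (1 - e * T / C)" by (subst sx) (simp add: algebra_simps)
      finally show ?thesis .
    qed
    moreover from this have "1 - e * T / C \<ge> 0"
      using T assms(5) by (metis zero_le_mult_iff not_less)
    ultimately show ?thesis by simp
  qed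
  then show "x = (x + s) * max 0 (1 - e * (x + s) / C)" by (simp add: T_def)
qed

lemma best_reply_sufficient:
  assumes "C > 0" "e > 0" "s > 0" "x \<ge> 0"
    and le: "C * s \<le> e * (x + s)\<^sup>2" and eq: "x > 0 \<Longrightarrow> C * s = e * (x + s)\<^sup>2"
  shows "best_reply C e s x"
  unfolding best_reply_def
proof (intro allI impI)
  fix y :: real assume y: "y \<ge> 0"
  define z where "z = C * s / ((x + s) * (y + s))"
  have pos: "(x + s) * (y + s) > 0" using assms y by simp
  have z: "z * ((x + s) * (y + s)) = C * s" using pos assms y by (simp add: z_def)
  have "(y - x) * (z - e) \<le> 0"
  proof (cases "y \<ge> x")
    case True
    have "e * ((x + s) * (x + s)) \<le> e * ((x + s) * (y + s))"
      using True assms by (intro mult_left_mono) auto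
    then have "z * ((x + s) * (y + s)) \<le> e * ((x + s) * (y + s))"
      using le z by (simp add: power2_eq_square)
    then have "z \<le> e" using pos by (rule mult_right_le_imp_le)
    then show ?thesis using True by (simp add: mult_le_0_iff)
  next
    case False
    then have "C * s = e * (x + s)\<^sup>2" using eq y by simp
    moreover have "e * ((x + s) * (y + s)) \<le> e * ((x + s) * (x + s))"
      using False assms by (intro mult_left_mono) auto
    ultimately have "e * ((x + s) * (y + s)) \<le> z * ((x + s) * (y + s))"
      unfolding z by (simp only: power2_eq_square)
    then have "e \<le> z" using pos by (rule mult_right_le_imp_le)
    then show ?thesis using False by (simp add: mult_le_0_iff)
  qed
  then show "C * (y / (y + s)) - e * y \<le> C * (x / (x + s)) - e * x"
    using contest_diff[OF assms(3,4) y, of C e] by (simp add: z_def)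
qed

lemma contest_unique:
  fixes x y c :: "'a \<Rightarrow> real"
  assumes "finite R" "C \<ge> 0" "\<forall>i\<in>R. 0 < c i" "\<forall>i\<in>R. 0 \<le> x i" "\<forall>i\<in>R. 0 \<le> y i"
    and bx: "\<forall>i\<in>R. best_reply C (c i) (sum x R - x i) (x i)"
    and b_y: "\<forall>i\<in>R. best_reply C (c i) (sum y R - y i) (y i)"
    and i: "i \<in> R"
  shows "x i = y i"
proof (cases "C = 0")
  case True
  then show ?thesis using best_reply_zero assms by metis
next
  case False
  then have C: "C > 0" using assms(2) by simp
  have key: "sum z R > 0 \<and> (\<forall>i\<in>R. z i = sum z R * max 0 (1 - c i * sum z R / C)) \<and>
      (\<Sum>i\<in>R. max 0 (1 - c i * sum z R / C)) = 1"
    if z: "\<forall>i\<in>R. 0 \<le> z i" "\<forall>i\<in>R. best_reply C (c i) (sum z R - z i) (z i)" for z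
  proof -
    have s: "sum z R - z i \<ge> 0" if "i \<in> R" for i
      using member_le_sum[of i R z] that z(1) assms(1) by auto
    have eq: "\<forall>i\<in>R. z i = sum z R * max 0 (1 - c i * sum z R / C)"
    proof
      fix j assume "j \<in> R"
      then show "z j = sum z R * max 0 (1 - c j * sum z R / C)"
        using best_reply_necessary(2)[of C "c j" "sum z R - z j" "z j"] z s C assms(3) by auto
    qed
    have pos: "sum z R > 0"
      using best_reply_necessary(1)[of C "c i" "sum z R - z i" "z i"] z s C assms(3) i by force
    have "sum z R = sum z R * (\<Sum>i\<in>R. max 0 (1 - c i * sum z R / C))"
    proof -
      have "(\<Sum>i\<in>R. z i) = (\<Sum>i\<in>R. sum z R * max 0 (1 - c i * sum z R / C))"
        by (rule sum.cong[OF refl]) (rule eq[rule_format])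
      also have "\<dots> = sum z R * (\<Sum>i\<in>R. max 0 (1 - c i * sum z R / C))"
        by (rule sum_distrib_left[symmetric])
      finally show ?thesis .
    qed
    then have "(\<Sum>i\<in>R. max 0 (1 - c i * sum z R / C)) = 1"
      using pos by (metis less_irrefl mult_cancel_left1)
    with pos eq show ?thesis by blast
  qed
  have no: False
    if T: "0 < T" "T < T'" and 1: "(\<Sum>i\<in>R. max 0 (1 - c i * T / C)) = 1"
      "(\<Sum>i\<in>R. max 0 (1 - c i * T' / C)) = 1" for T T' :: real
  proof -
    have mono: "c i * T / C < c i * T' / C" if "i \<in> R" for i
      using that T C assms(3) by (intro divide_strict_right_mono mult_strict_left_mono) auto
    have "\<exists>i\<in>R. max 0 (1 - c i * T' / C) \<noteq> 0"
    proof (rule ccontr)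
      assume "\<not> ?thesis"
      then have "(\<Sum>i\<in>R. max 0 (1 - c i * T' / C)) = 0" by (intro sum.neutral) blast
      then show False using 1(2) by linarith
    qed
    then obtain k where k: "k \<in> R" "1 - c k * T' / C > 0"
      by (metis max.absorb1 not_less)
    have "(\<Sum>i\<in>R. max 0 (1 - c i * T' / C)) < (\<Sum>i\<in>R. max 0 (1 - c i * T / C))"
    proof (rule sum_strict_mono_ex1[OF assms(1)])
      show "\<forall>i\<in>R. max 0 (1 - c i * T' / C) \<le> max 0 (1 - c i * T / C)"
        using mono by (intro ballI max.mono) (auto intro: less_imp_le)
      show "\<exists>i\<in>R. max 0 (1 - c i * T' / C) < max 0 (1 - c i * T / C)"
        using k mono[OF k(1)] by (intro bexI[of _ k]) (auto simp: max_def)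
    qed
    then show False unfolding 1 by simp
  qed
  note kx = key[OF assms(4) bx] and ky = key[OF assms(5) b_y]
  have "sum x R = sum y R"
  proof (rule linorder_cases[of "sum x R" "sum y R"])
    assume "sum x R < sum y R"
    then show ?thesis using no[of "sum x R" "sum y R"] kx ky by blast
  next
    assume "sum y R < sum x R"
    then show ?thesis using no[of "sum y R" "sum x R"] kx ky by blast
  qed
  then show ?thesis using kx ky i by metis
qed

lemma contest_exists:
  fixes c :: "'a \<Rightarrow> real"
  assumes "set \<sigma> = R" "distinct \<sigma>" "sorted (map c \<sigma>)" "2 \<le> card R" "\<forall>i\<in>R. 0 < c i"
    and C: "C \<ge> 0"
  defines "S \<equiv> active_set c \<sigma>"
  defines "x \<equiv> \<lambda>i. if i \<in> S then C * response_coeff c S i else 0"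
  shows "\<forall>i\<in>R. 0 \<le> x i \<and> best_reply C (c i) (sum x R - x i) (x i)"
proof -
  note S = active_set_spec[OF assms(1-5), folded S_def]
  have finR: "finite R" using assms(1) by auto
  have fin: "finite S" using S(1) finR finite_subset by blast
  define E where "E = sum c S"
  define n where "n = real (card S) - 1"
  have n: "n \<ge> 1" using S(2) by (simp add: n_def)
  have "S \<noteq> {}" using S(2) by auto
  then have E: "E > 0" using fin S(1) assms(5) unfolding E_def by (intro sum_pos) auto
  have k: "response_coeff c S i = n / E * (1 - n * c i / E)" for i
    by (simp add: response_coeff_def n_def E_def)
  have kpos: "response_coeff c S i > 0" if "i \<in> S" for i
    unfolding k using that S(3) n E by (intro mult_pos_pos) (auto simp: n_def E_def field_simps)
  define T where "T = C * n / E"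
  have "sum x R = (\<Sum>i\<in>S. C * response_coeff c S i)"
    unfolding x_def using S(1) finR by (simp add: sum.If_cases Int_absorb1)
  also have "\<dots> = T * (\<Sum>i\<in>S. 1 - n * c i / E)"
    unfolding k T_def sum_distrib_left by (intro sum.cong) auto
  also have "(\<Sum>i\<in>S. 1 - n * c i / E) = real (card S) - n * E / E"
    by (simp add: sum_subtractf E_def sum_distrib_left sum_divide_distrib)
  also have "\<dots> = 1" using E by (simp add: n_def)
  finally have sumx: "sum x R = T" by simp
  show ?thesis
  proof
    fix i assume i: "i \<in> R"
    have ci: "c i > 0" using i assms(5) by simp
    have x0: "x i \<ge> 0" using kpos C by (auto simp: x_def less_imp_le)
    show "0 \<le> x i \<and> best_reply C (c i) (sum x R - x i) (x i)"
    proof (cases "C = 0")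
      case True
      then show ?thesis using ci x0 by (auto simp: best_reply_def x_def)
    next
      case False
      then have C: "C > 0" using C by simp
      have T: "T > 0" using C n E by (simp add: T_def)
      have "best_reply C (c i) (T - x i) (x i)"
      proof (cases "i \<in> S")
        case True
        then have "x i = T * (1 - n * c i / E)" by (simp add: x_def k T_def)
        then have s: "T - x i = T * (n * c i / E)" by (simp add: algebra_simps)
        have "T - x i > 0" unfolding s using T n E ci by simp
        moreover have "C * (T - x i) = c i * (x i + (T - x i))\<^sup>2"
        proof -
          have "x i + (T - x i) = T" by simp
          then show ?thesis unfolding s by (simp add: T_def power2_eq_square)
        qed
        ultimately show ?thesis using C ci x0 by (intro best_reply_sufficient) auto
      next
        case False
        then have x: "x i = 0" by (simp add: x_def)
        have "E \<le> n * c i" using False i S(4) by (simp add: n_def E_def)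
        then have "C \<le> T * c i" using E C by (simp add: T_def field_simps)
        then have "C * T \<le> c i * T\<^sup>2" using T by (simp add: power2_eq_square mult.commute mult.left_commute)
        then show ?thesis using C ci T x by (intro best_reply_sufficient) auto
      qed
      then show ?thesis using x0 sumx by simp
    qed
  qed
qed

lemma follower_equilibrium_iff:
  assumes "finite R" "finite F"
  shows "follower_equilibrium R F e C r \<longleftrightarrow> r \<in> R \<rightarrow>\<^sub>E (F \<rightarrow>\<^sub>E {0..}) \<and>
    (\<forall>f\<in>F. \<forall>i\<in>R. best_reply (C f) (e i f) ((\<Sum>j\<in>R. r j f) - r i f) (r i f))"
    (is "_ \<longleftrightarrow> ?feas \<and> ?best")
proof -
  have dev: "follower_utility R F e C i (r(i := a)) =
      (\<Sum>f\<in>F. C f * (a f / (a f + ((\<Sum>j\<in>R. r j f) - r i f))) - e i f * a f)"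
    if "i \<in> R" for i a
  proof -
    have "(\<Sum>j\<in>R. (r(i := a)) j f) = a f + ((\<Sum>j\<in>R. r j f) - r i f)" for f
      using that assms(1) by (simp add: sum.remove[of R i])
    then show ?thesis by (simp add: follower_utility_def)
  qed
  have self: "follower_utility R F e C i r =
      (\<Sum>f\<in>F. C f * (r i f / (r i f + ((\<Sum>j\<in>R. r j f) - r i f))) - e i f * r i f)" for i
    by (simp add: follower_utility_def)
  have "?best" if eq: "follower_equilibrium R F e C r"
    unfolding best_reply_def
  proof (intro ballI allI impI)
    fix f i and y :: real assume f: "f \<in> F" and i: "i \<in> R" and y: "y \<ge> 0"
    define g where
      "g = (\<lambda>h z. C h * (z / (z + ((\<Sum>j\<in>R. r j h) - r i h))) - e i h * z)"
    have "(r i)(f := y) \<in> F \<rightarrow>\<^sub>E {0..}"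
      using eq i f y unfolding follower_equilibrium_def nash_equilibrium_def
      by (auto simp: PiE_iff extensional_def)
    then have "follower_utility R F e C i (r(i := (r i)(f := y))) \<le> follower_utility R F e C i r"
      using eq i unfolding follower_equilibrium_def nash_equilibrium_def by blast
    then have "(\<Sum>h\<in>F. g h (((r i)(f := y)) h)) \<le> (\<Sum>h\<in>F. g h (r i h))"
      unfolding dev[OF i] self g_def .
    moreover have "(\<Sum>h\<in>F - {f}. g h (((r i)(f := y)) h)) = (\<Sum>h\<in>F - {f}. g h (r i h))"
      by (intro sum.cong) auto
    ultimately have "g f y \<le> g f (r i f)"
      using f assms(2) by (simp add: sum.remove[of F f])
    then show "C f * (y / (y + ((\<Sum>j\<in>R. r j f) - r i f))) - e i f * y
      \<le> C f * (r i f / (r i f + ((\<Sum>j\<in>R. r j f) - r i f))) - e i f * r i f"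
      by (simp add: g_def)
  qed
  moreover have "follower_equilibrium R F e C r" if "?feas" "?best"
    unfolding follower_equilibrium_def nash_equilibrium_def
  proof (intro conjI ballI)
    show "?feas" by fact
    fix i a assume i: "i \<in> R" and a: "a \<in> F \<rightarrow>\<^sub>E {0::real..}"
    show "follower_utility R F e C i (r(i := a)) \<le> follower_utility R F e C i r"
      unfolding dev[OF i] self
    proof (rule sum_mono)
      fix f assume f: "f \<in> F"
      then have "a f \<ge> 0" using a by auto
      then show "C f * (a f / (a f + ((\<Sum>j\<in>R. r j f) - r i f))) - e i f * a f
        \<le> C f * (r i f / (r i f + ((\<Sum>j\<in>R. r j f) - r i f))) - e i f * r i f"
        using \<open>?best\<close> f i unfolding best_reply_def by blast
    qed
  qed
  ultimately show ?thesis
    unfolding follower_equilibrium_def nash_equilibrium_def by blast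
qed

lemma follower_equilibrium_explicit:
  assumes "finite R" "finite F" "2 \<le> card R" "\<And>i f. i \<in> R \<Longrightarrow> f \<in> F \<Longrightarrow> 0 < e i f"
    and "\<And>f. f \<in> F \<Longrightarrow> 0 \<le> C f"
    and "\<And>f. f \<in> F \<Longrightarrow> set (\<sigma> f) = R \<and> distinct (\<sigma> f) \<and> sorted (map (\<lambda>i. e i f) (\<sigma> f))"
  shows "follower_equilibrium R F e C (\<lambda>i\<in>R. \<lambda>f\<in>F.
    let S = active_set (\<lambda>i. e i f) (\<sigma> f)
    in if i \<in> S then C f * response_coeff (\<lambda>i. e i f) S i else 0)" (is "follower_equilibrium _ _ _ _ ?r")
proof -
  define x where "x = (\<lambda>f i. if i \<in> active_set (\<lambda>i. e i f) (\<sigma> f)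
    then C f * response_coeff (\<lambda>i. e i f) (active_set (\<lambda>i. e i f) (\<sigma> f)) i else 0)"
  have x: "\<forall>i\<in>R. 0 \<le> x f i \<and> best_reply (C f) (e i f) (sum (x f) R - x f i) (x f i)"
    if "f \<in> F" for f
    unfolding x_def
    by (rule contest_exists) (use that assms(3-6) in auto)
  have r: "?r = (\<lambda>i\<in>R. \<lambda>f\<in>F. x f i)" by (simp add: x_def Let_def)
  show ?thesis
    unfolding r follower_equilibrium_iff[OF assms(1,2)]
    using x by (auto simp: PiE_iff)
qed

lemma follower_equilibrium_unique:
  assumes "finite R" "finite F" "2 \<le> card R" "\<And>i f. i \<in> R \<Longrightarrow> f \<in> F \<Longrightarrow> 0 < e i f"
    and "\<And>f. f \<in> F \<Longrightarrow> 0 \<le> C f"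
  shows "\<exists>!r. follower_equilibrium R F e C r"
proof (rule ex_ex1I)
  obtain l where l: "set l = R" "distinct l" using finite_distinct_list[OF assms(1)] by blast
  show "\<exists>r. follower_equilibrium R F e C r"
  proof
    show "follower_equilibrium R F e C (\<lambda>i\<in>R. \<lambda>f\<in>F.
      let S = active_set (\<lambda>i. e i f) (sort_key (\<lambda>i. e i f) l)
      in if i \<in> S then C f * response_coeff (\<lambda>i. e i f) S i else 0)"
      by (rule follower_equilibrium_explicit) (use assms l in auto)
  qed
next
  fix r r' assume eq: "follower_equilibrium R F e C r" "follower_equilibrium R F e C r'"
  then have feas: "r \<in> R \<rightarrow>\<^sub>E (F \<rightarrow>\<^sub>E {0..})" "r' \<in> R \<rightarrow>\<^sub>E (F \<rightarrow>\<^sub>E {0..})"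
    and best: "\<forall>f\<in>F. \<forall>i\<in>R. best_reply (C f) (e i f) ((\<Sum>j\<in>R. r j f) - r i f) (r i f)"
      "\<forall>f\<in>F. \<forall>i\<in>R. best_reply (C f) (e i f) ((\<Sum>j\<in>R. r' j f) - r' i f) (r' i f)"
    unfolding follower_equilibrium_iff[OF assms(1,2)] by blast+
  have nonneg: "0 \<le> r i f" "0 \<le> r' i f" if "i \<in> R" "f \<in> F" for i f
    using feas that by (auto simp: PiE_iff)
  have same: "r i f = r' i f" if "i \<in> R" "f \<in> F" for i f
    using contest_unique[OF assms(1) assms(5)[OF that(2)], of "\<lambda>i. e i f" "\<lambda>i. r i f" "\<lambda>i. r' i f" i]
      best nonneg assms(4) that by blast
  have "r i = r' i" if "i \<in> R" for i
  proof (rule PiE_ext)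
    show "r i \<in> F \<rightarrow>\<^sub>E {0..}" "r' i \<in> F \<rightarrow>\<^sub>E {0..}" using feas that by auto
  qed (use same that in blast)
  then show "r = r'" using feas by (auto intro: PiE_ext)
qed

lemma follower_response_explicit:
  assumes "finite R" "finite F" "2 \<le> card R" "\<And>i f. i \<in> R \<Longrightarrow> f \<in> F \<Longrightarrow> 0 < e i f"
    and "\<And>f. f \<in> F \<Longrightarrow> 0 \<le> C f"
    and "\<And>f. f \<in> F \<Longrightarrow> set (\<sigma> f) = R \<and> distinct (\<sigma> f) \<and> sorted (map (\<lambda>i. e i f) (\<sigma> f))"
    and "i \<in> R" "f \<in> F"
  defines "S \<equiv> active_set (\<lambda>i. e i f) (\<sigma> f)"
  shows "follower_response R F e C i f =
    (if i \<in> S then C f * response_coeff (\<lambda>i. e i f) S i else 0)"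
proof -
  have "follower_response R F e C = (\<lambda>i\<in>R. \<lambda>f\<in>F.
    let S = active_set (\<lambda>i. e i f) (\<sigma> f)
    in if i \<in> S then C f * response_coeff (\<lambda>i. e i f) S i else 0)"
    unfolding follower_response_def
  proof (rule the1_equality)
    show "\<exists>!r. follower_equilibrium R F e C r"
      by (rule follower_equilibrium_unique) (use assms in auto)
    show "follower_equilibrium R F e C (\<lambda>i\<in>R. \<lambda>f\<in>F.
      let S = active_set (\<lambda>i. e i f) (\<sigma> f)
      in if i \<in> S then C f * response_coeff (\<lambda>i. e i f) S i else 0)"
      by (rule follower_equilibrium_explicit) (use assms in auto)
  qed
  then show ?thesis using assms(7,8) by (simp add: S_def Let_def)
qed

end

theory Submission
  imports Defs
begin

text \<open>
  The followers' response is linear in the payments, \<open>r i f = C f * k i f\<close> with \<open>k\<close> independent of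
  \<open>C\<close>, so the utility of a flow depends on its own payment only and the leaders' game splits into
  one-variable maximisation problems. For each flow the objective
  \<open>x \<mapsto> u f (\<Sum>i\<in>R. ln (1 + x * k i f)) - x\<close> has a strictly decreasing derivative, and this
  derivative is negative for large \<open>x\<close> because \<open>k / (1 + x * k) \<le> 1 / x\<close>.
\<close>

section \<open>Maximisation of one-variable functions on the half-line\<close>

lemma DERIV_within_Ici_imp_DERIV:
  fixes f :: "real \<Rightarrow> real"
  assumes "(f has_real_derivative D) (at x within {a..})" "a < x"
  shows "(f has_real_derivative D) (at x)"
proof -
  have "at x within {a..} = at x"
    by (rule at_within_open_subset[of _ "{a<..}"]) (use assms(2) in auto)
  then show ?thesis
    using assms(1) by simp
qed

text \<open>Past \<open>B\<close> the slope is negative, so a maximiser on the compact interval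
  \<open>{0..B}\<close> is global. Two maximisers would force a nonpositive slope followed by a
  nonnegative one, which a strictly decreasing \<open>h'\<close> forbids. No continuity of
  \<open>h'\<close> is assumed: both arguments use only mean values.\<close>

lemma decreasing_deriv_unique_maximiser:
  fixes h h' :: "real \<Rightarrow> real"
  assumes deriv: "\<And>x. 0 \<le> x \<Longrightarrow> (h has_real_derivative h' x) (at x within {0..})"
    and decr: "\<And>x y. 0 \<le> x \<Longrightarrow> x < y \<Longrightarrow> h' y < h' x"
    and B: "0 \<le> B" "h' B \<le> 0"
  shows "\<exists>!x. 0 \<le> x \<and> (\<forall>y\<ge>0. h y \<le> h x)"
proof (rule ex_ex1I)
  have cont: "continuous_on {0..} h"
    unfolding continuous_on_eq_continuous_within by (auto intro: DERIV_continuous[OF deriv])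
  \<comment> \<open>The left endpoint may be \<open>0\<close>, where \<open>h\<close> has only a
    one-sided derivative. The mean value point lies strictly inside, where the derivative within
    \<open>{0..}\<close> is the ordinary one.\<close>
  have mvt: "\<exists>z>x. z < y \<and> h y - h x = (y - x) * h' z" if "0 \<le> x" "x < y" for x y
  proof -
    have "continuous_on {x..y} h"
      by (rule continuous_on_subset[OF cont]) (use that in auto)
    moreover have der: "(h has_real_derivative h' z) (at z)" if "x < z" for z
      using that \<open>0 \<le> x\<close> by (intro DERIV_within_Ici_imp_DERIV[OF deriv]) auto
    ultimately obtain l z where "x < z" "z < y" "DERIV h z :> l" "h y - h x = (y - x) * l"
      using MVT[OF \<open>x < y\<close>, of h] real_differentiable_def by blast
    then show ?thesis
      using der DERIV_unique by blast
  qed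
  have "continuous_on {0..B} h"
    by (rule continuous_on_subset[OF cont]) auto
  then obtain x where x: "x \<in> {0..B}" "\<And>y. y \<in> {0..B} \<Longrightarrow> h y \<le> h x"
    using continuous_attains_sup[of "{0..B}" h] B(1) by auto
  have "h y \<le> h x" if "0 \<le> y" for y
  proof (cases "y \<le> B")
    case False
    then obtain z where "B < z" "h y - h B = (y - B) * h' z"
      using mvt[of B y] B(1) by auto
    moreover have "h' z < 0"
      using decr[of B z] B \<open>B < z\<close> by linarith
    ultimately have "h y - h B \<le> 0"
      using False by (simp add: mult_le_0_iff)
    then show ?thesis
      using x(2)[of B] B(1) by simp
  qed (use x that in auto)
  then show "\<exists>x. 0 \<le> x \<and> (\<forall>y\<ge>0. h y \<le> h x)"
    using x(1) by auto
  have not_less: "\<not> x < y" if max: "0 \<le> x" "\<forall>y\<ge>0. h y \<le> h x" "\<forall>x\<ge>0. h x \<le> h y" for x y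
  proof
    assume "x < y"
    \<comment> \<open>An intermediate point \<open>m\<close> lies no higher than either maximiser.
      Mean values on its two sides therefore give \<open>h' z1\<close> \<le> 0 \<le>
      \<open>h' z2\<close> with \<open>z1 < z2\<close>.\<close>
    then obtain m where m: "x < m" "m < y"
      using dense by blast
    then have "0 \<le> m"
      using max(1) by linarith
    obtain z1 where z1: "x < z1" "z1 < m" "h m - h x = (m - x) * h' z1"
      using mvt[OF max(1) m(1)] by blast
    obtain z2 where z2: "m < z2" "h y - h m = (y - m) * h' z2"
      using mvt[OF \<open>0 \<le> m\<close> m(2)] by blast
    have "h m \<le> h x" "h m \<le> h y"
      using max(2,3) \<open>0 \<le> m\<close> by blast+
    then have "(m - x) * h' z1 \<le> 0" "0 \<le> (y - m) * h' z2"
      using z1(3) z2(2) by linarith+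
    then have "h' z1 \<le> 0" "0 \<le> h' z2"
      using m by (auto simp: mult_le_0_iff zero_le_mult_iff)
    moreover have "h' z2 < h' z1"
      using decr z1 z2 max(1) by auto
    ultimately show False
      by linarith
  qed
  then show "x = y" if "0 \<le> x \<and> (\<forall>y\<ge>0. h y \<le> h x)" "0 \<le> y \<and> (\<forall>z\<ge>0. h z \<le> h y)" for x y
  proof -
    have "\<not> x < y" "\<not> y < x"
      using not_less that by blast+
    then show ?thesis
      by linarith
  qed
qed

text \<open>The derivative of the objective is \<open>u' (g x) * g' x - 1\<close>. Along increasing
  \<open>x\<close>, the positive factor \<open>u' (g x)\<close> does not increase, because
  \<open>u'\<close> is nonincreasing and \<open>g\<close> nondecreasing, while \<open>g'\<close>
  strictly decreases. Strictness comes from the logarithms alone, so a linear \<open>u\<close> is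
  covered.\<close>

lemma concave_log_sum_unique_maximiser:
  fixes u u' u'' :: "real \<Rightarrow> real" and k :: "'a \<Rightarrow> real"
  assumes fin: "finite R" and k0: "\<And>i. i \<in> R \<Longrightarrow> 0 \<le> k i" and pos: "j \<in> R" "0 < k j"
    and u: "\<And>x. 0 \<le> x \<Longrightarrow> (u has_real_derivative u' x) (at x within {0..})"
    and u': "\<And>x. 0 \<le> x \<Longrightarrow> (u' has_real_derivative u'' x) (at x within {0..})"
    and u'_pos: "\<And>x. 0 \<le> x \<Longrightarrow> 0 < u' x"
    and u''_nonpos: "\<And>x. 0 \<le> x \<Longrightarrow> u'' x \<le> 0"
  shows "\<exists>!x. 0 \<le> x \<and> (\<forall>y\<ge>0. u (\<Sum>i\<in>R. ln (1 + y * k i)) - y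
    \<le> u (\<Sum>i\<in>R. ln (1 + x * k i)) - x)"
proof -
  define g where "g = (\<lambda>x. \<Sum>i\<in>R. ln (1 + x * k i))"
  define g' where "g' = (\<lambda>x. \<Sum>i\<in>R. k i / (1 + x * k i))"
  have den: "0 < 1 + x * k i" if "0 \<le> x" "i \<in> R" for x i
    using mult_nonneg_nonneg[OF that(1) k0[OF that(2)]] by linarith
  have g: "(g has_real_derivative g' x) (at x within {0..})" if "0 \<le> x" for x
    unfolding g_def g'_def
    by (rule DERIV_sum) (use den[OF that] in \<open>auto intro!: derivative_eq_intros\<close>)
  have g_mono: "g x \<le> g y" if "0 \<le> x" "x \<le> y" for x y
    unfolding g_def
  proof (rule sum_mono)
    fix i assume i: "i \<in> R"
    show "ln (1 + x * k i) \<le> ln (1 + y * k i)"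
      using den[OF that(1) i] mult_right_mono[OF that(2) k0[OF i]] by simp
  qed
  have g_nonneg: "0 \<le> g x" if "0 \<le> x" for x
    using g_mono[of 0 x] that by (simp add: g_def)
  have u'_cont: "continuous_on {0..} u'"
    unfolding continuous_on_eq_continuous_within by (auto intro: DERIV_continuous[OF u'])
  have u'_mono: "u' y \<le> u' x" if "0 \<le> x" "x \<le> y" for x y
  proof (rule DERIV_nonpos_imp_decreasing_open[OF that(2)])
    show "continuous_on {x..y} u'"
      by (rule continuous_on_subset[OF u'_cont]) (use that in auto)
    show "\<exists>D. DERIV u' z :> D \<and> D \<le> 0" if "x < z" "z < y" for z
      using that \<open>0 \<le> x\<close> u''_nonpos
      by (intro exI[of _ "u'' z"] conjI DERIV_within_Ici_imp_DERIV[OF u']) auto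
  qed
  have g'_decr: "g' y < g' x" if "0 \<le> x" "x < y" for x y
    unfolding g'_def
  proof (rule sum_strict_mono_ex1[OF fin])
    show "\<forall>i\<in>R. k i / (1 + y * k i) \<le> k i / (1 + x * k i)"
      using that k0 den by (intro ballI divide_left_mono add_left_mono mult_right_mono) auto
    \<comment> \<open>Summands with coefficient zero stay constant; the positive coefficient
      \<open>k j\<close> supplies the strict decrease.\<close>
    have "k j / (1 + y * k j) < k j / (1 + x * k j)"
      using that pos den[OF that(1) pos(1)] den[of y j]
      by (intro divide_strict_left_mono) auto
    then show "\<exists>i\<in>R. k i / (1 + y * k i) < k i / (1 + x * k i)"
      using pos(1) by blast
  qed
  have g'_nonneg: "0 \<le> g' x" if "0 \<le> x" for x
    unfolding g'_def using k0 den[OF that] by (intro sum_nonneg divide_nonneg_pos) auto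
  have g'_bound: "g' x \<le> card R / x" if "0 < x" for x
  proof -
    have "g' x \<le> (\<Sum>i\<in>R. 1 / x)"
      unfolding g'_def
    proof (rule sum_mono)
      fix i assume "i \<in> R"
      then show "k i / (1 + x * k i) \<le> 1 / x"
        using den[of x i] that by (simp add: divide_simps mult.commute)
    qed
    then show ?thesis by simp
  qed
  have "\<exists>!x. 0 \<le> x \<and> (\<forall>y\<ge>0. u (g y) - y \<le> u (g x) - x)"
  proof (rule decreasing_deriv_unique_maximiser)
    show "((\<lambda>x. u (g x) - x) has_real_derivative u' (g x) * g' x - 1) (at x within {0..})"
      if x: "0 \<le> x" for x
    proof -
      \<comment> \<open>Since \<open>g\<close> maps the half-line into itself, the one-sided
        derivative of \<open>u\<close> restricts to the image of \<open>g\<close>. This makes the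
        chain rule valid also at \<open>x = 0\<close>, where \<open>g x = 0\<close>.\<close>
      have "(u has_real_derivative u' (g x)) (at (g x) within g ` {0..})"
        by (rule DERIV_subset[OF u]) (use g_nonneg x in auto)
      then have "((\<lambda>x. u (g x)) has_real_derivative u' (g x) * g' x) (at x within {0..})"
        using DERIV_image_chain[OF _ g[OF x], of u] by (simp add: o_def)
      then show ?thesis by (intro DERIV_diff DERIV_ident)
    qed
    show "u' (g y) * g' y - 1 < u' (g x) * g' x - 1" if "0 \<le> x" "x < y" for x y
    proof -
      have "u' (g y) * g' y \<le> u' (g x) * g' y"
        using that by (intro mult_right_mono u'_mono g_nonneg g_mono g'_nonneg) auto
      also have "\<dots> < u' (g x) * g' x"
        using that by (intro mult_strict_left_mono g'_decr u'_pos g_nonneg)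
      finally show ?thesis by simp
    qed
    \<comment> \<open>This \<open>B\<close> solves \<open>u' 0 * (card R / B) = 1\<close>, where
      \<open>u' 0\<close> bounds \<open>u' (g B)\<close> and \<open>card R / B\<close> bounds
      \<open>g' B\<close>.\<close>
    define B where "B = u' 0 * card R"
    have "0 < card R"
      using fin pos(1) by (auto simp: card_gt_0_iff)
    then have B: "0 < B"
      using u'_pos[of 0] by (simp add: B_def)
    show "0 \<le> B"
      using B by simp
    have "u' (g B) * g' B \<le> u' 0 * (card R / B)"
      using B u'_pos[of 0]
      by (intro mult_mono u'_mono g'_bound g'_nonneg g_nonneg) auto
    also have "\<dots> = 1"
      using u'_pos[of 0] \<open>0 < card R\<close> by (simp add: B_def)
    finally show "u' (g B) * g' B - 1 \<le> 0" by simp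
  qed
  then show ?thesis by (simp add: g_def)
qed

section \<open>Linearity of the followers' response in the payments\<close>

lemma response_coeff_pos:
  assumes "2 \<le> card S" "i \<in> S" "\<And>j. j \<in> S \<Longrightarrow> 0 < c j"
    and "(real (card S) - 1) * c i < sum c S"
  shows "0 < response_coeff c S i"
proof -
  have "finite S"
    using assms(1) card.infinite by fastforce
  then have "0 < sum c S"
    using assms(2,3) by (intro sum_pos) auto
  then show ?thesis
    unfolding response_coeff_def using assms(1,4) by (intro mult_pos_pos) auto
qed

text \<open>The active sets are built from the costs alone, so one family \<open>k\<close> serves
  all nonnegative payments. It vanishes off the active set and is positive on it, and every active
  set has at least two members; this gives each flow the positive coefficient that strict
  monotonicity requires.\<close>

lemma follower_response_linear:
  fixes e :: "'a \<Rightarrow> 'f \<Rightarrow> real"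
  assumes R: "finite R" "2 \<le> card R" and F: "finite F"
    and e: "\<And>i f. i \<in> R \<Longrightarrow> f \<in> F \<Longrightarrow> 0 < e i f"
  shows "\<exists>k. (\<forall>i\<in>R. \<forall>f\<in>F. 0 \<le> k i f) \<and> (\<forall>f\<in>F. \<exists>i\<in>R. 0 < k i f) \<and>
    (\<forall>C. (\<forall>f\<in>F. 0 \<le> C f) \<longrightarrow>
      (\<forall>i\<in>R. \<forall>f\<in>F. follower_response R F e C i f = C f * k i f))"
proof -
  obtain l where l: "set l = R" "distinct l"
    using finite_distinct_list[OF R(1)] by blast
  define \<sigma> where "\<sigma> = (\<lambda>f. sort_key (\<lambda>i. e i f) l)"
  have \<sigma>: "set (\<sigma> f) = R" "distinct (\<sigma> f)" "sorted (map (\<lambda>i. e i f) (\<sigma> f))" for f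
    using l by (auto simp: \<sigma>_def)
  define S where "S = (\<lambda>f. active_set (\<lambda>i. e i f) (\<sigma> f))"
  define k where "k = (\<lambda>i f. if i \<in> S f then response_coeff (\<lambda>i. e i f) (S f) i else 0)"
  have S: "S f \<subseteq> R" "2 \<le> card (S f)"
    "\<forall>i\<in>S f. (real (card (S f)) - 1) * e i f < (\<Sum>i\<in>S f. e i f)" if "f \<in> F" for f
    using active_set_spec[OF \<sigma>[of f] R(2)] e that unfolding S_def by auto
  have pos: "0 < response_coeff (\<lambda>i. e i f) (S f) i" if "f \<in> F" "i \<in> S f" for i f
    using S[OF that(1)] that e by (intro response_coeff_pos) auto
  show ?thesis
  proof (intro exI[of _ k] conjI allI impI ballI)
    show "0 \<le> k i f" if "i \<in> R" "f \<in> F" for i f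
      using pos[OF that(2), of i] by (auto simp: k_def)
    show "\<exists>i\<in>R. 0 < k i f" if "f \<in> F" for f
    proof -
      have "S f \<noteq> {}"
        using S(2)[OF that] by auto
      then obtain i where "i \<in> S f" by blast
      then show ?thesis
        using S(1)[OF that] pos[OF that] by (auto simp: k_def)
    qed
    show "follower_response R F e C i f = C f * k i f"
      if "\<forall>f\<in>F. 0 \<le> C f" "i \<in> R" "f \<in> F" for C i f
      using follower_response_explicit[OF R(1) F R(2) e, where C = C and \<sigma> = \<sigma> and i = i and f = f] \<sigma> that
      by (simp add: k_def S_def)
  qed
qed

section \<open>Reduction of the leaders' game to independent one-player problems\<close>

lemma separable_nash_unique:
  assumes sep: "\<And>i s. i \<in> P \<Longrightarrow> s \<in> Pi\<^sub>E P A \<Longrightarrow> U i s = h i (s i)"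
    and uniq: "\<And>i. i \<in> P \<Longrightarrow> \<exists>!x. x \<in> A i \<and> (\<forall>y\<in>A i. h i y \<le> h i x)"
  shows "\<exists>!s. nash_equilibrium P A U s"
proof -
  \<comment> \<open>A unilateral deviation stays in the product of the strategy sets, so
    \<open>sep\<close> applies to the deviated profile as well. The equilibrium condition then says
    that each coordinate maximises its own \<open>h i\<close>.\<close>
  have nash: "nash_equilibrium P A U s \<longleftrightarrow>
    s \<in> Pi\<^sub>E P A \<and> (\<forall>i\<in>P. \<forall>y\<in>A i. h i y \<le> h i (s i))" for s
  proof -
    have "U i (s(i := a)) = h i a" if "s \<in> Pi\<^sub>E P A" "i \<in> P" "a \<in> A i" for i a
    proof -
      have "s(i := a) \<in> Pi\<^sub>E P A"
        using that by (auto simp: PiE_iff extensional_def)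
      then show ?thesis
        using sep that(2) by simp
    qed
    then show ?thesis
      unfolding nash_equilibrium_def using sep by (metis (no_types, lifting))
  qed
  define best where "best = (\<lambda>i. THE x. x \<in> A i \<and> (\<forall>y\<in>A i. h i y \<le> h i x))"
  have best: "best i \<in> A i \<and> (\<forall>y\<in>A i. h i y \<le> h i (best i))" if "i \<in> P" for i
    unfolding best_def by (rule theI') (rule uniq[OF that])
  show ?thesis
  proof (rule ex1I)
    \<comment> \<open>Profiles in \<open>Pi\<^sub>E P A\<close> are \<open>undefined\<close> outside
      \<open>P\<close>. Restricting \<open>best\<close> gives it this form, so coordinatewise
      uniqueness on \<open>P\<close> yields equality of functions.\<close>
    show "nash_equilibrium P A U (restrict best P)"
      unfolding nash using best by auto
  next
    fix s assume "nash_equilibrium P A U s"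
    then have s: "s \<in> Pi\<^sub>E P A" "\<forall>i\<in>P. \<forall>y\<in>A i. h i y \<le> h i (s i)"
      unfolding nash by auto
    show "s = restrict best P"
    proof (rule PiE_ext[OF s(1)])
      show "restrict best P \<in> Pi\<^sub>E P A"
        using best by auto
      fix i assume i: "i \<in> P"
      then have "s i \<in> A i"
        using s(1) by auto
      then have "s i = best i"
        using uniq[OF i] best[OF i] s(2) i by blast
      then show "s i = restrict best P i"
        using i by simp
    qed
  qed
qed

theorem theorem3:
  fixes F :: "'f set" and R :: "'a set" and e :: "'a \<Rightarrow> 'f \<Rightarrow> real"
    and u u' u'' :: "'f \<Rightarrow> real \<Rightarrow> real"
  assumes "finite F" and "finite R" and "2 \<le> card R"
    and "\<And>i f. i \<in> R \<Longrightarrow> f \<in> F \<Longrightarrow> 0 < e i f"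
    and "\<And>f x. f \<in> F \<Longrightarrow> 0 \<le> x \<Longrightarrow>
      (u f has_real_derivative u' f x) (at x within {0..})"
    and "\<And>f. f \<in> F \<Longrightarrow> continuous_on {0..} (u' f)"
    and "\<And>f x. f \<in> F \<Longrightarrow> 0 \<le> x \<Longrightarrow>
      (u' f has_real_derivative u'' f x) (at x within {0..})"
    and "\<And>f x. f \<in> F \<Longrightarrow> 0 \<le> x \<Longrightarrow> 0 < u' f x"
    and "\<And>f x. f \<in> F \<Longrightarrow> 0 \<le> x \<Longrightarrow> u'' f x \<le> 0"
    and "\<And>f. f \<in> F \<Longrightarrow> u f 0 = 0"
  shows "\<exists>!C. leader_equilibrium R F e u C"
proof -
  obtain k where k: "\<forall>i\<in>R. \<forall>f\<in>F. 0 \<le> k i f" "\<forall>f\<in>F. \<exists>i\<in>R. 0 < k i f"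
    "\<forall>C. (\<forall>f\<in>F. 0 \<le> C f) \<longrightarrow>
      (\<forall>i\<in>R. \<forall>f\<in>F. follower_response R F e C i f = C f * k i f)"
    using follower_response_linear[OF assms(2,3,1), of e] assms(4) by blast
  define h where "h = (\<lambda>f x. u f (\<Sum>i\<in>R. ln (1 + x * k i f)) - x)"
  show ?thesis
    unfolding leader_equilibrium_def
  proof (rule separable_nash_unique)
    fix f C assume f: "f \<in> F" and C: "C \<in> F \<rightarrow>\<^sub>E {0::real..}"
    \<comment> \<open>The linear form of the response holds for payments that are nonnegative for
      every flow, not just for \<open>f\<close>; feasibility of the whole profile provides
      this.\<close>
    have "\<forall>f\<in>F. 0 \<le> C f"
      using C by auto
    then show "leader_utility R F e u f C = h f (C f)"
      using f by (simp add: leader_utility_def h_def k(3))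
  next
    fix f assume f: "f \<in> F"
    obtain j where j: "j \<in> R" "0 < k j f"
      using k(2) f by blast
    have "\<exists>!x. 0 \<le> x \<and> (\<forall>y\<ge>0. h f y \<le> h f x)"
      unfolding h_def
      by (rule concave_log_sum_unique_maximiser[where k = "\<lambda>i. k i f" and u' = "u' f"
            and u'' = "u'' f", OF assms(2) _ j])
        (use f k(1) assms(5,7-9) in auto)
    then show "\<exists>!x. x \<in> {0..} \<and> (\<forall>y\<in>{0..}. h f y \<le> h f x)"
      by (simp add: Ball_def)
  qed
qed

end
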